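(* Let $1<t\le2$, $q=3-t$, $0<h\le1$, $L\ge1$, and let $\nu=\sum_i\alpha_i\delta_{p_i}$ be a finite atomic probability measure ($\alpha_i>0$, $\sum_i\alpha_i=1$) with points $p_i$ in a fixed bounded planar slope–intercept chart, repetitions among the $p_i$ being allowed, such that $$\nu(B(p,\rho))\le L\rho^t\qquad(h\le\rho\le1)$$ for all points $p$. For each $i$ let $Y_i$ be an arbitrary measurable subset of the constant-width $h$-tube with parameter $p_i$, and put $$\Lambda=h^{-1}\sum_i\alpha_i|Y_i| .$$ Then for every $\varepsilon>0$, $$\Bigl|\bigcup_iY_i\Bigr|\gtrsim_{\varepsilon,t}L^{-q}h^{\varepsilon}\Lambda^{q}.$$ The constant is independent of the number of atoms, the least positive weight, repeated parameters, and the individual shading densities.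
   Context: The chart is $I_s\times I_t\subset\mathbb R^2$ for fixed bounded intervals. For $p=(s,\tau)$ in the chart, $\Gamma_p=\{(x,sx+\tau):x\in I_x\}$ is the corresponding line segment over a fixed bounded interval $I_x$, and the $h$-tube with parameter $p$ is $\{z\in\mathbb R^2:\operatorname{dist}(z,\Gamma_p)<Ah\}$ (truncated at its ends to a fixed enlargement of $I_x$), with $A\ge1$ a fixed constant. $|\cdot|$ is planar Lebesgue measure. Implicit constants may also depend on the fixed chart intervals and on $A$. *)

theory Defs
  imports "HOL-Analysis.Analysis"
begin

definition line_seg :: "real set \<Rightarrow> real \<times> real \<Rightarrow> (real \<times> real) set" where
  "line_seg Ix p = (\<lambda>x. (x, fst p * x + snd p)) ` Ix"

text \<open>
  The truncation interval \<open>Jx\<close> is meant to be a fixed enlargement of \<open>Ix\<close>. Only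
  nonempty \<open>Ix\<close> are meaningful, because \<open>infdist z {} = 0\<close>. The norm on
  \<open>real \<times> real\<close> is the Euclidean one.
\<close>

definition tube :: "real set \<Rightarrow> real set \<Rightarrow> real \<Rightarrow> real \<Rightarrow> real \<times> real \<Rightarrow> (real \<times> real) set" where
  "tube Ix Jx A h p = {z. infdist z (line_seg Ix p) < A * h \<and> fst z \<in> Jx}"

text \<open>
  The measure \<open>\<Sum>i<n. \<alpha> i \<cdot> \<delta>(p i)\<close> is obtained as the image under \<open>p\<close> of the measure on
  the index set \<open>{..<n}\<close> with weights \<open>\<alpha>\<close>, so the weights of repeated points add up.
\<close>

definition atomic_measure :: "nat \<Rightarrow> (nat \<Rightarrow> real) \<Rightarrow> (nat \<Rightarrow> real \<times> real) \<Rightarrow> (real \<times> real) measure" where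
  "atomic_measure n \<alpha> p = distr (point_measure {..<n} (\<lambda>i. ennreal (\<alpha> i))) borel p"

lemma emeasure_atomic_measure:
  assumes "B \<in> sets borel"
  shows "emeasure (atomic_measure n \<alpha> p) B = (\<Sum>i | i < n \<and> p i \<in> B. ennreal (\<alpha> i))"
proof -
  have m: "p \<in> measurable (point_measure {..<n} (\<lambda>i. ennreal (\<alpha> i))) borel"
    by simp
  have e: "p -` B \<inter> {..<n} = {i. i < n \<and> p i \<in> B}" by auto
  have "emeasure (atomic_measure n \<alpha> p) B
      = emeasure (point_measure {..<n} (\<lambda>i. ennreal (\<alpha> i))) {i. i < n \<and> p i \<in> B}"
    unfolding atomic_measure_def by (simp add: emeasure_distr[OF m assms] space_point_measure e)
  also have "\<dots> = (\<Sum>i | i < n \<and> p i \<in> B. ennreal (\<alpha> i))"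
    by (rule emeasure_point_measure_finite) auto
  finally show ?thesis .
qed

lemma measure_atomic_measure:
  assumes "B \<in> sets borel" and "\<And>i. i < n \<Longrightarrow> 0 \<le> \<alpha> i"
  shows "measure (atomic_measure n \<alpha> p) B = (\<Sum>i | i < n \<and> p i \<in> B. \<alpha> i)"
proof -
  have "emeasure (atomic_measure n \<alpha> p) B = ennreal (\<Sum>i | i < n \<and> p i \<in> B. \<alpha> i)"
    unfolding emeasure_atomic_measure[OF assms(1)] by (rule sum_ennreal) (use assms(2) in auto)
  moreover have "0 \<le> (\<Sum>i | i < n \<and> p i \<in> B. \<alpha> i)"
    by (rule sum_nonneg) (use assms(2) in auto)
  ultimately show ?thesis
    by (simp add: measure_def)
qed

lemma emeasure_atomic_measure_UNIV_eq_1: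
  assumes "\<And>i. i < n \<Longrightarrow> 0 \<le> \<alpha> i"
  shows "emeasure (atomic_measure n \<alpha> p) UNIV = 1 \<longleftrightarrow> (\<Sum>i<n. \<alpha> i) = 1"
proof -
  have "emeasure (atomic_measure n \<alpha> p) UNIV = (\<Sum>i<n. ennreal (\<alpha> i))"
    by (simp add: emeasure_atomic_measure lessThan_def)
  also have "\<dots> = ennreal (\<Sum>i<n. \<alpha> i)"
    by (rule sum_ennreal) (use assms in auto)
  finally show ?thesis by (simp add: ennreal_eq_1)
qed

end

theory Submission imports Defs begin

text \<open>
  The proof is an \<open>L\<^sup>2\<close>--\<open>L\<^sup>\<infinity>\<close> argument on the dyadic pieces of a smoothed point-line dual
  of \<open>\<nu>\<close>. For \<open>r > 0\<close> let \<open>F\<^sub>r(x, y)\<close> be \<open>1/r\<close> times the \<open>\<nu>\<close>-mass of the parameters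
  \<open>(s, \<tau>)\<close> with \<open>\<bar>y - s x - \<tau>\<bar> \<le> r\<close> (below: \<open>avg\<close>), and let \<open>G\<^sub>r = F\<^sub>r - F\<^bsub>2r\<^esub>\<close> (below: \<open>osc\<close>).
  Each tube lies in a vertical strip of half-width comparable to \<open>h\<close>, so with \<open>E = \<Union>\<^sub>i Y\<^sub>i\<close>
  the quantity \<open>\<Lambda>\<close> is at most a constant times the integral of \<open>F\<^sub>r\<close> over \<open>E\<close> for \<open>r \<sim> h\<close>, and
  \<open>F\<^sub>r\<close> telescopes into a harmless term at scale \<open>1\<close> and about \<open>log (1/h)\<close> terms \<open>G\<^sub>r\<close>
  with \<open>h \<lesssim> r \<lesssim> 1\<close>. Two bounds hold for each of them.

  \<^item> Pointwise, \<open>\<bar>G\<^sub>r\<bar> \<lesssim> L r\<^bsup>t-2\<^esup>\<close>: the parameters of the \<open>r\<close>-strips through a given point lie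
    in an \<open>r\<close>-neighbourhood of a segment, which about \<open>1/r\<close> balls of radius \<open>\<sim> r\<close> cover
    (\<open>frostman_strip\<close>, \<open>abs_osc_le\<close>).

  \<^item> In mean square, \<open>\<integral> w G\<^sub>r\<^sup>2 \<lesssim> log (1/h) L r\<^bsup>t-1\<^esup>\<close> for a Lipschitz cutoff \<open>w\<close> in \<open>x\<close>. Expanding
    the square gives a double sum over parameters. As the profile of \<open>G\<^sub>r\<close> has mean zero, the
    term of a pair with slope difference \<open>a\<close> is at most a constant times \<open>min (1/r) (r/a\<^sup>2)\<close>
    instead of \<open>min (1/r) (1/\<bar>a\<bar>)\<close>, and it vanishes unless the distance of the parameters is
    \<open>\<lesssim> \<bar>a\<bar> + r\<close>; summing over dyadic \<open>\<bar>a\<bar>\<close> with the ball condition gives the bound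
    (\<open>abs_integral_pair_int_le\<close>, \<open>integral_cutoff_osc_square_le\<close>).

  Hence \<open>X = \<integral>\<^sub>E \<bar>G\<^sub>r\<bar>\<close> satisfies both \<open>X \<lesssim> \<bar>E\<bar> L r\<^bsup>t-2\<^esup>\<close> and \<open>X\<^sup>2 \<lesssim> log (1/h) \<bar>E\<bar> L r\<^bsup>t-1\<^esup>\<close>. In the
  product \<open>X\<^bsup>3-t\<^esup> = X\<^bsup>t-1\<^esup> (X\<^sup>2)\<^bsup>2-t\<^esup>\<close> all powers of \<open>r\<close> cancel, which is where the exponent
  \<open>q = 3 - t\<close> comes from (\<open>powr_interpolation\<close>). Summing over the scales yields
  \<open>\<Lambda>\<^bsup>q\<^esup> \<lesssim> (log (1/h))\<^sup>3 L \<bar>E\<bar>\<close>; the logarithm is absorbed by \<open>h\<^bsup>\<epsilon>\<^esup>\<close>, and \<open>L\<^bsup>1-q\<^esup> \<le> 1\<close>.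
\<close>

section \<open>Cancellation of a mean-zero profile against a Lipschitz cutoff\<close>

definition pulse :: "real \<Rightarrow> real \<Rightarrow> real" where
  "pulse r u = (if \<bar>u\<bar> \<le> r then 1 / r else 0)"

definition wave :: "real \<Rightarrow> real \<Rightarrow> real" where
  "wave r u = pulse r u - pulse (2 * r) u"

text \<open>
  A sharp cutoff would not do: the gain from cancellation needs a Lipschitz function.
\<close>

definition cutoff :: "real \<Rightarrow> real \<Rightarrow> real" where
  "cutoff m x = max 0 (m + 1 - \<bar>x\<bar>)"

lemma borel_measurable_pulse [measurable]: "pulse r \<in> borel_measurable borel"
  unfolding pulse_def by measurable

lemma borel_measurable_wave [measurable]: "wave r \<in> borel_measurable borel"
  unfolding wave_def by measurable

lemma borel_measurable_cutoff [measurable]: "cutoff m \<in> borel_measurable borel"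
  unfolding cutoff_def by measurable

lemma integrable_bounded_support:
  fixes f :: "'a::euclidean_space \<Rightarrow> real"
  assumes "f \<in> borel_measurable borel" and "\<And>x. \<bar>f x\<bar> \<le> B"
    and "\<And>x. x \<notin> cbox a b \<Longrightarrow> f x = 0"
  shows "integrable lborel f"
  by (rule integrableI_bounded_set[where A = "cbox a b" and B = B])
     (use assms emeasure_lborel_cbox_finite[of a b] in auto)

lemma abs_integral_le_support:
  fixes f :: "real \<Rightarrow> real"
  assumes f: "f \<in> borel_measurable borel" and b: "\<And>x. \<bar>f x\<bar> \<le> B"
    and s: "\<And>x. \<bar>x\<bar> > l \<Longrightarrow> f x = 0" and l: "0 \<le> l"
  shows "\<bar>\<integral>x. f x \<partial>lborel\<bar> \<le> 2 * l * B"
proof -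
  have B: "0 \<le> B" using b[of 0] by linarith
  have fi: "integrable lborel f"
    by (rule integrable_bounded_support[OF f b, of "-l" l]) (use s in auto)
  have "\<bar>\<integral>x. f x \<partial>lborel\<bar> \<le> (\<integral>x. \<bar>f x\<bar> \<partial>lborel)"
    by (rule integral_abs_bound)
  also have "\<dots> \<le> (\<integral>x. indicator {-l..l} x * B \<partial>lborel)"
  proof (rule integral_mono)
    show "integrable lborel (\<lambda>x. \<bar>f x\<bar>)" using fi by simp
    show "integrable lborel (\<lambda>x. indicator {-l..l} x * B)"
      by (intro integrable_mult_left integrable_real_indicator) (use l in auto)
    fix x show "\<bar>f x\<bar> \<le> indicator {-l..l} x * B"
      using b[of x] s[of x] by (cases "\<bar>x\<bar> > l") (auto simp: indicator_def)
  qed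
  also have "\<dots> = 2 * l * B" using l by simp
  finally show ?thesis .
qed

lemma integral_pulse: "r > 0 \<Longrightarrow> (\<integral>u. pulse r u \<partial>lborel) = 2"
proof -
  assume r: "r > 0"
  have "pulse r = (\<lambda>u. indicator {-r..r} u * (1 / r))"
    by (auto simp: pulse_def indicator_def fun_eq_iff)
  then show ?thesis using r by simp
qed

lemma integrable_pulse: "integrable lborel (pulse r)"
  by (rule integrable_bounded_support[where B = "\<bar>1 / r\<bar>" and a = "-r" and b = r]) (auto simp: pulse_def)

lemma abs_wave_le: "r > 0 \<Longrightarrow> \<bar>wave r u\<bar> \<le> 1 / r"
  by (auto simp: wave_def pulse_def field_simps)

lemma wave_eq_0: "r > 0 \<Longrightarrow> 2 * r < \<bar>u\<bar> \<Longrightarrow> wave r u = 0"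
  by (auto simp: wave_def pulse_def)

lemma integrable_wave: "integrable lborel (wave r)"
  unfolding wave_def by (intro Bochner_Integration.integrable_diff integrable_pulse)

lemma integral_wave: "r > 0 \<Longrightarrow> (\<integral>u. wave r u \<partial>lborel) = 0"
  unfolding wave_def
  by (subst Bochner_Integration.integral_diff) (auto simp: integral_pulse intro: integrable_pulse)

lemma cutoff_lipschitz: "\<bar>cutoff m x - cutoff m y\<bar> \<le> \<bar>x - y\<bar>"
  unfolding cutoff_def by linarith

lemma cutoff_nonneg: "0 \<le> cutoff m x"
  by (simp add: cutoff_def)

lemma cutoff_le: "0 \<le> m \<Longrightarrow> cutoff m x \<le> m + 1"
  by (simp add: cutoff_def)

lemma cutoff_eq_0: "m + 1 < \<bar>x\<bar> \<Longrightarrow> cutoff m x = 0"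
  by (simp add: cutoff_def)

lemma cutoff_ge_1: "\<bar>x\<bar> \<le> m \<Longrightarrow> 1 \<le> cutoff m x"
  by (simp add: cutoff_def)

lemma integral_cutoff_wave_trivial:
  assumes r: "0 < r" and m: "0 \<le> m"
  shows "\<bar>\<integral>x. cutoff m x * wave r (u + a * x) \<partial>lborel\<bar> \<le> 2 * (m + 1)\<^sup>2 / r"
proof -
  have "\<bar>\<integral>x. cutoff m x * wave r (u + a * x) \<partial>lborel\<bar> \<le> 2 * (m + 1) * ((m + 1) * (1 / r))"
  proof (rule abs_integral_le_support)
    show "\<bar>cutoff m x * wave r (u + a * x)\<bar> \<le> (m + 1) * (1 / r)" for x
      unfolding abs_mult
      by (intro mult_mono) (use m cutoff_nonneg[of m x] cutoff_le[OF m, of x] abs_wave_le[OF r] in auto)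
  qed (use m in \<open>auto simp: cutoff_eq_0\<close>)
  moreover have "2 * (m + 1) * ((m + 1) * (1 / r)) = 2 * (m + 1)\<^sup>2 / r"
    by (simp add: power2_eq_square)
  ultimately show ?thesis by (simp only:)
qed

text \<open>
  On the support of the wave, an interval of length comparable to \<open>r/\<bar>a\<bar>\<close>, the Lipschitz cutoff
  is constant up to \<open>2 r/\<bar>a\<bar>\<close>, and a constant is annihilated because the wave has mean zero.
  This gains the factor \<open>r/\<bar>a\<bar>\<close> over the bound by the length of the support times the height.
\<close>

lemma integral_cutoff_wave_cancel:
  assumes r: "0 < r" and m: "0 \<le> m" and a: "a \<noteq> 0"
  shows "\<bar>\<integral>x. cutoff m x * wave r (u + a * x) \<partial>lborel\<bar> \<le> 8 * r / a\<^sup>2"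
proof -
  let ?g = "\<lambda>v. cutoff m ((v - u) / a) * wave r v"
  let ?d = "\<lambda>v. (cutoff m ((v - u) / a) - cutoff m (- u / a)) * wave r v"
  have bd: "\<bar>?d v\<bar> \<le> (2 * r / \<bar>a\<bar>) * (1 / r)" for v
  proof (cases "2 * r < \<bar>v\<bar>")
    case True then show ?thesis using r by (simp add: wave_eq_0)
  next
    case False
    have "\<bar>cutoff m ((v - u) / a) - cutoff m (- u / a)\<bar> \<le> \<bar>(v - u) / a - (- u / a)\<bar>"
      by (rule cutoff_lipschitz)
    also have "(v - u) / a - (- u / a) = v / a" using a by (simp add: field_simps)
    also have "\<bar>v / a\<bar> \<le> 2 * r / \<bar>a\<bar>" using False a by (simp add: abs_divide divide_right_mono)
    finally show ?thesis
      unfolding abs_mult by (intro mult_mono) (use r abs_wave_le[OF r] in auto)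
  qed
  have di: "integrable lborel ?d"
    by (rule integrable_bounded_support[OF _ bd, where a = "-(2*r)" and b = "2*r"]) (use r in \<open>auto simp: wave_eq_0\<close>)
  have "(\<integral>v. ?g v \<partial>lborel) = (\<integral>v. ?d v + cutoff m (- u / a) * wave r v \<partial>lborel)"
    by (rule Bochner_Integration.integral_cong) (auto simp: algebra_simps)
  also have "\<dots> = (\<integral>v. ?d v \<partial>lborel)"
    by (subst Bochner_Integration.integral_add[OF di]) (auto simp: integral_wave[OF r] integrable_wave)
  finally have e: "(\<integral>v. ?g v \<partial>lborel) = (\<integral>v. ?d v \<partial>lborel)" .
  have "(\<integral>v. ?g v \<partial>lborel) = \<bar>a\<bar> *\<^sub>R (\<integral>x. ?g (u + a * x) \<partial>lborel)"
    by (rule lborel_integral_real_affine[OF a])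
  also have "\<dots> = \<bar>a\<bar> * (\<integral>x. cutoff m x * wave r (u + a * x) \<partial>lborel)"
    using a by simp
  finally have "\<bar>a\<bar> * \<bar>\<integral>x. cutoff m x * wave r (u + a * x) \<partial>lborel\<bar> = \<bar>\<integral>v. ?d v \<partial>lborel\<bar>"
    using e by (simp add: abs_mult)
  also have "\<dots> \<le> 2 * (2 * r) * ((2 * r / \<bar>a\<bar>) * (1 / r))"
    by (rule abs_integral_le_support[OF _ bd]) (use r in \<open>auto simp: wave_eq_0\<close>)
  also have "\<dots> = \<bar>a\<bar> * (8 * r / a\<^sup>2)"
    using r a by (simp add: field_simps power2_eq_square)
  finally have "\<bar>a\<bar> * \<bar>\<integral>x. cutoff m x * wave r (u + a * x) \<partial>lborel\<bar> \<le> \<bar>a\<bar> * (8 * r / a\<^sup>2)" .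
  then show ?thesis by (rule mult_left_le_imp_le) (use a in simp)
qed

text \<open>
  The integrand that a pair of parameters contributes to the square of \<open>osc\<close>, with the cutoff.
\<close>

definition pair_int :: "real \<Rightarrow> real \<Rightarrow> real \<times> real \<Rightarrow> real \<times> real \<Rightarrow> real \<times> real \<Rightarrow> real" where
  "pair_int m r p p' z = cutoff m (fst z) * (wave r (snd z - fst p * fst z - snd p)
      * wave r (snd z - fst p' * fst z - snd p'))"

lemma borel_measurable_pair_int [measurable]: "pair_int m r p p' \<in> borel_measurable borel"
  unfolding pair_int_def borel_prod[symmetric] by measurable

lemma integrable_pair_int:
  assumes r: "0 < r" and m: "0 \<le> m"
  shows "integrable lborel (pair_int m r p p')"
proof -
  define R where "R = 2 * r + \<bar>fst p\<bar> * (m + 1) + \<bar>snd p\<bar>"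
  show ?thesis
  proof (rule integrable_bounded_support[where a = "(-(m+1), -R)" and b = "(m+1, R)"
        and B = "(m + 1) * (1 / r * (1 / r))"])
    show "\<bar>pair_int m r p p' z\<bar> \<le> (m + 1) * (1 / r * (1 / r))" for z
      unfolding pair_int_def abs_mult
      by (intro mult_mono) (use m r cutoff_nonneg cutoff_le[OF m] abs_wave_le[OF r] in auto)
    fix z :: "real \<times> real" assume z: "z \<notin> cbox (-(m+1), -R) (m+1, R)"
    then have z': "m + 1 < \<bar>fst z\<bar> \<or> (\<bar>fst z\<bar> \<le> m + 1 \<and> R < \<bar>snd z\<bar>)"
      by (cases z) (auto simp: cbox_Pair_eq)
    show "pair_int m r p p' z = 0"
    proof (cases "m + 1 < \<bar>fst z\<bar>")
      case True then show ?thesis by (simp add: pair_int_def cutoff_eq_0)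
    next
      case False
      with z' have "\<bar>fst p * fst z\<bar> \<le> \<bar>fst p\<bar> * (m + 1)" and "R < \<bar>snd z\<bar>"
        by (auto simp: abs_mult mult_left_mono)
      then have "2 * r < \<bar>snd z - fst p * fst z - snd p\<bar>" unfolding R_def by linarith
      then show ?thesis using r by (simp add: pair_int_def wave_eq_0)
    qed
  qed simp
qed

text \<open>
  The shear \<open>u = y - s x - \<tau>\<close> followed by an exchange of the integrals leaves
  one wave in \<open>u\<close>, which is integrated in absolute value, and a one-dimensional integral in \<open>x\<close>,
  to which the cancellation applies.
\<close>

lemma integral_pair_int:
  assumes r: "0 < r" and m: "0 \<le> m"
    and J: "\<And>u. \<bar>\<integral>x. cutoff m x * wave r (u + (fst p - fst p') * x) \<partial>lborel\<bar> \<le> J"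
  shows "\<bar>\<integral>z. pair_int m r p p' z \<partial>lborel\<bar> \<le> 4 * J"
proof -
  define a where "a = fst p - fst p'"
  define b where "b = snd p - snd p'"
  have J0: "0 \<le> J" using J[of 0] by linarith
  let ?k = "\<lambda>x u. cutoff m x * (wave r u * wave r (u + b + a * x))"
  have ki: "integrable (lborel \<Otimes>\<^sub>M lborel) (case_prod ?k)"
    unfolding lborel_prod
  proof (rule integrable_bounded_support[where a = "(-(m+1), -(2*r))" and b = "(m+1, 2*r)"
        and B = "(m + 1) * (1 / r * (1 / r))"])
    show "(\<lambda>(x, u). ?k x u) \<in> borel_measurable borel"
      unfolding borel_prod[symmetric] by measurable
    fix z :: "real \<times> real"
    show "\<bar>case z of (x, u) \<Rightarrow> ?k x u\<bar> \<le> (m + 1) * (1 / r * (1 / r))"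
      unfolding case_prod_beta abs_mult
      by (intro mult_mono) (use m r cutoff_nonneg cutoff_le[OF m] abs_wave_le[OF r] in auto)
    assume "z \<notin> cbox (-(m+1), -(2*r)) (m+1, 2*r)"
    then have "m + 1 < \<bar>fst z\<bar> \<or> 2 * r < \<bar>snd z\<bar>"
      by (cases z) (auto simp: cbox_Pair_eq)
    then show "(case z of (x, u) \<Rightarrow> ?k x u) = 0"
      using r by (auto simp: case_prod_beta cutoff_eq_0 wave_eq_0)
  qed
  have "(\<integral>z. pair_int m r p p' z \<partial>lborel) = (\<integral>x. \<integral>y. pair_int m r p p' (x, y) \<partial>lborel \<partial>lborel)"
    using lborel_pair.integral_fst'[of "pair_int m r p p'"] integrable_pair_int[OF r m]
    by (simp add: lborel_prod)
  also have "\<dots> = (\<integral>x. \<integral>u. ?k x u \<partial>lborel \<partial>lborel)"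
  proof (rule Bochner_Integration.integral_cong[OF refl])
    fix x :: real
    show "(\<integral>y. pair_int m r p p' (x, y) \<partial>lborel) = (\<integral>u. ?k x u \<partial>lborel)"
      by (subst lborel_integral_real_affine[where c = 1 and t = "fst p * x + snd p"])
         (auto simp: pair_int_def a_def b_def algebra_simps)
  qed
  also have "\<dots> = (\<integral>u. \<integral>x. ?k x u \<partial>lborel \<partial>lborel)"
    using lborel_pair.Fubini_integral[OF ki] by simp
  also have "\<dots> = (\<integral>u. wave r u * (\<integral>x. cutoff m x * wave r (u + b + a * x) \<partial>lborel) \<partial>lborel)"
  proof (rule Bochner_Integration.integral_cong[OF refl])
    fix u :: real
    show "(\<integral>x. ?k x u \<partial>lborel) = wave r u * (\<integral>x. cutoff m x * wave r (u + b + a * x) \<partial>lborel)"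
      by (subst integral_mult_right_zero[symmetric]) (simp add: mult_ac)
  qed
  also have "\<bar>\<dots>\<bar> \<le> 2 * (2 * r) * (1 / r * J)"
  proof (rule abs_integral_le_support)
    show "\<bar>wave r u * (\<integral>x. cutoff m x * wave r (u + b + a * x) \<partial>lborel)\<bar> \<le> 1 / r * J" for u
      unfolding abs_mult a_def
      by (intro mult_mono abs_wave_le r J) (use r in auto)
    show "(\<lambda>u. wave r u * (\<integral>x. cutoff m x * wave r (u + b + a * x) \<partial>lborel)) \<in> borel_measurable borel"
      by measurable
  qed (use r in \<open>auto simp: wave_eq_0\<close>)
  also have "\<dots> = 4 * J" using r by simp
  finally show ?thesis .
qed

text \<open>
  Over the support of the cutoff two strips with nearly equal slopes meet only if their intercepts
  are close too; therefore the slope difference controls the distance of interacting parameters.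
\<close>

lemma integral_pair_int_eq_0:
  assumes r: "0 < r"
    and far: "4 * r + (m + 1) * \<bar>fst p - fst p'\<bar> < \<bar>snd p - snd p'\<bar>"
  shows "(\<integral>z. pair_int m r p p' z \<partial>lborel) = 0"
proof -
  have "pair_int m r p p' z = 0" for z
  proof (cases "m + 1 < \<bar>fst z\<bar>")
    case True then show ?thesis by (simp add: pair_int_def cutoff_eq_0)
  next
    case False
    let ?u = "snd z - fst p * fst z - snd p" and ?v = "snd z - fst p' * fst z - snd p'"
    have "\<bar>(fst p - fst p') * fst z\<bar> \<le> (m + 1) * \<bar>fst p - fst p'\<bar>"
      using False by (subst mult.commute) (simp add: abs_mult mult_right_mono)
    moreover have "?v - ?u = (fst p - fst p') * fst z + (snd p - snd p')"
      by (simp add: algebra_simps)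
    ultimately have "2 * r < \<bar>?u\<bar> \<or> 2 * r < \<bar>?v\<bar>" using far by linarith
    then show ?thesis using r by (auto simp: pair_int_def wave_eq_0)
  qed
  then show ?thesis by simp
qed

section \<open>Strip averages of a Frostman measure\<close>

definition avg :: "nat \<Rightarrow> (nat \<Rightarrow> real) \<Rightarrow> (nat \<Rightarrow> real \<times> real) \<Rightarrow> real \<Rightarrow> real \<times> real \<Rightarrow> real" where
  "avg n \<alpha> p r z = (\<Sum>i<n. \<alpha> i * pulse r (snd z - fst (p i) * fst z - snd (p i)))"

definition osc :: "nat \<Rightarrow> (nat \<Rightarrow> real) \<Rightarrow> (nat \<Rightarrow> real \<times> real) \<Rightarrow> real \<Rightarrow> real \<times> real \<Rightarrow> real" where
  "osc n \<alpha> p r z = (\<Sum>i<n. \<alpha> i * wave r (snd z - fst (p i) * fst z - snd (p i)))"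

text \<open>
  The ball condition is imposed for all \<open>\<rho> \<ge> h\<close>. For a probability measure and \<open>L \<ge> 1\<close> it holds
  automatically for \<open>\<rho> > 1\<close>, and radii that are constant multiples of the scale can then be used
  freely.
\<close>

definition frostman :: "nat \<Rightarrow> (nat \<Rightarrow> real) \<Rightarrow> (nat \<Rightarrow> real \<times> real) \<Rightarrow> real \<Rightarrow> real \<Rightarrow> real \<Rightarrow> bool" where
  "frostman n \<alpha> p h L t \<longleftrightarrow> (\<forall>i<n. 0 \<le> \<alpha> i) \<and> (\<Sum>i<n. \<alpha> i) = 1 \<and>
     (\<forall>z \<rho>. h \<le> \<rho> \<longrightarrow> (\<Sum>i | i < n \<and> p i \<in> ball z \<rho>. \<alpha> i) \<le> L * \<rho> powr t)"

lemma borel_measurable_avg [measurable]: "avg n \<alpha> p r \<in> borel_measurable borel"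
  unfolding avg_def borel_prod[symmetric] by measurable

lemma borel_measurable_osc [measurable]: "osc n \<alpha> p r \<in> borel_measurable borel"
  unfolding osc_def borel_prod[symmetric] by measurable

lemma dist_prod_le: "dist (z::real \<times> real) w \<le> \<bar>fst z - fst w\<bar> + \<bar>snd z - snd w\<bar>"
proof -
  have "dist z w = sqrt ((fst z - fst w)\<^sup>2 + (snd z - snd w)\<^sup>2)"
    by (simp add: dist_prod_def dist_real_def)
  also have "\<dots> \<le> \<bar>fst z - fst w\<bar> + \<bar>snd z - snd w\<bar>" by (rule sqrt_sum_squares_le_sum_abs)
  finally show ?thesis .
qed

lemma avg_telescope:
  "avg n \<alpha> p r z = avg n \<alpha> p (2 ^ N * r) z + (\<Sum>k<N. osc n \<alpha> p (2 ^ k * r) z)"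
proof (induction N)
  case (Suc N)
  have "avg n \<alpha> p (2 ^ N * r) z = avg n \<alpha> p (2 ^ Suc N * r) z + osc n \<alpha> p (2 ^ N * r) z"
    by (simp add: avg_def osc_def wave_def mult.assoc right_diff_distrib sum_subtractf)
  with Suc show ?case by simp
qed simp

text \<open>
  The parameters of lines passing within \<open>2 r\<close> of a point form a strip of width comparable to \<open>r\<close>
  around a segment; sorting them by \<open>\<lfloor>s/r\<rfloor>\<close> covers the strip by at most \<open>(2 \<bar>S\<bar> + 3 B)/r\<close> balls of
  radius \<open>(m + 4) r\<close>.
\<close>

lemma frostman_strip:
  assumes fr: "frostman n \<alpha> p h L t" and S: "\<And>i. i < n \<Longrightarrow> \<bar>fst (p i)\<bar> \<le> S"
    and L: "0 \<le> L" and t: "0 \<le> t" "t \<le> 2" and r: "0 < r" "h \<le> r" "r \<le> B"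
    and x: "\<bar>x\<bar> \<le> m"
  shows "(\<Sum>i | i < n \<and> \<bar>y - fst (p i) * x - snd (p i)\<bar> \<le> 2 * r. \<alpha> i)
    \<le> (2 * \<bar>S\<bar> + 3 * B) * (m + 4)\<^sup>2 * L * r powr (t - 1)"
proof -
  define I where "I = {i. i < n \<and> \<bar>y - fst (p i) * x - snd (p i)\<bar> \<le> 2 * r}"
  define g where "g = (\<lambda>i. \<lfloor>fst (p i) / r\<rfloor>)"
  define K where "K = {- \<lfloor>\<bar>S\<bar> / r + 1\<rfloor>..\<lfloor>\<bar>S\<bar> / r + 1\<rfloor>}"
  have m: "0 \<le> m" using x by linarith
  have fI: "finite I" by (simp add: I_def)
  have gK: "g ` I \<subseteq> K"
  proof
    fix k assume "k \<in> g ` I"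
    then obtain i where i: "i < n" "k = g i" by (auto simp: I_def)
    have "\<bar>fst (p i) / r\<bar> \<le> \<bar>S\<bar> / r"
      using S[OF i(1)] r by (simp add: abs_divide divide_right_mono)
    then have "\<bar>real_of_int k\<bar> \<le> \<bar>S\<bar> / r + 1" unfolding i g_def by linarith
    then have "k \<le> \<lfloor>\<bar>S\<bar> / r + 1\<rfloor>" "- k \<le> \<lfloor>\<bar>S\<bar> / r + 1\<rfloor>"
      unfolding le_floor_iff by linarith+
    then show "k \<in> K" by (simp add: K_def)
  qed
  have ball: "p i \<in> ball (k * r, y - k * r * x) ((m + 4) * r)" if "i \<in> I" "g i = k" for i and k :: int
  proof -
    have "k \<le> fst (p i) / r" "fst (p i) / r < k + 1" using that(2) unfolding g_def by linarith+
    then have a: "\<bar>k * r - fst (p i)\<bar> \<le> r" using r by (simp add: field_simps abs_if)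
    have "\<bar>(k * r - fst (p i)) * x\<bar> \<le> r * m"
      unfolding abs_mult by (intro mult_mono) (use a x r in auto)
    moreover have "\<bar>y - fst (p i) * x - snd (p i)\<bar> \<le> 2 * r" using that by (simp add: I_def)
    moreover have "y - k * r * x - snd (p i) = (y - fst (p i) * x - snd (p i)) - (k * r - fst (p i)) * x"
      by (simp add: algebra_simps)
    ultimately have "\<bar>y - k * r * x - snd (p i)\<bar> \<le> 2 * r + r * m" by linarith
    with a have "dist (k * r, y - k * r * x) (p i) \<le> r + (2 * r + r * m)"
      using dist_prod_le[of "(k * r, y - k * r * x)" "p i"] by simp
    also have "\<dots> < (m + 4) * r" using r by (simp add: algebra_simps)
    finally show ?thesis by (simp add: dist_commute)
  qed
  have pw: "((m + 4) * r) powr t \<le> (m + 4)\<^sup>2 * r powr t"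
  proof -
    have "((m + 4) * r) powr t = (m + 4) powr t * r powr t" using m r by (simp add: powr_mult)
    also have "(m + 4) powr t \<le> (m + 4) powr 2" using m t by (intro powr_mono) auto
    also have "(m + 4) powr 2 = (m + 4)\<^sup>2" using m by simp
    finally show ?thesis by (simp add: mult_right_mono)
  qed
  have "(\<Sum>i\<in>I. \<alpha> i) = (\<Sum>k\<in>K. \<Sum>i | i \<in> I \<and> g i = k. \<alpha> i)"
    by (rule sum.group[symmetric]) (use fI gK in \<open>auto simp: K_def\<close>)
  also have "\<dots> \<le> (\<Sum>k\<in>K. (m + 4)\<^sup>2 * L * r powr t)"
  proof (rule sum_mono)
    fix k assume "k \<in> K"
    have "(\<Sum>i | i \<in> I \<and> g i = k. \<alpha> i)
        \<le> (\<Sum>i | i < n \<and> p i \<in> ball (k * r, y - k * r * x) ((m + 4) * r). \<alpha> i)"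
    proof (rule sum_mono2)
      show "{i \<in> I. g i = k} \<subseteq> {i. i < n \<and> p i \<in> ball (k * r, y - k * r * x) ((m + 4) * r)}"
        using ball unfolding I_def by blast
    qed (use fr in \<open>auto simp: frostman_def\<close>)
    also have "\<dots> \<le> L * ((m + 4) * r) powr t"
    proof -
      have "r \<le> (m + 4) * r" using m r by simp
      then have "h \<le> (m + 4) * r" using r by linarith
      then show ?thesis using fr unfolding frostman_def by blast
    qed
    also have "\<dots> \<le> L * ((m + 4)\<^sup>2 * r powr t)" using pw L by (rule mult_left_mono)
    finally show "(\<Sum>i | i \<in> I \<and> g i = k. \<alpha> i) \<le> (m + 4)\<^sup>2 * L * r powr t"
      by (simp add: mult_ac)
  qed
  also have "\<dots> = card K * ((m + 4)\<^sup>2 * L * r powr t)" by simp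
  also have "\<dots> \<le> ((2 * \<bar>S\<bar> + 3 * B) / r) * ((m + 4)\<^sup>2 * L * r powr t)"
  proof (rule mult_right_mono)
    have "0 \<le> \<lfloor>\<bar>S\<bar> / r + 1\<rfloor>" using r by (simp add: le_floor_iff)
    then have "real (card K) = 2 * of_int \<lfloor>\<bar>S\<bar> / r + 1\<rfloor> + 1" by (simp add: K_def)
    also have "\<dots> \<le> 2 * (\<bar>S\<bar> / r + 1) + 1" by (intro add_mono mult_left_mono of_int_floor_le) auto
    also have "\<dots> = (2 * \<bar>S\<bar> + 3 * r) / r" using r by (simp add: field_simps)
    also have "\<dots> \<le> (2 * \<bar>S\<bar> + 3 * B) / r" using r by (intro divide_right_mono) auto
    finally show "real (card K) \<le> (2 * \<bar>S\<bar> + 3 * B) / r" .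
  qed (use L in auto)
  also have "\<dots> = (2 * \<bar>S\<bar> + 3 * B) * (m + 4)\<^sup>2 * L * r powr (t - 1)"
    using r by (simp add: powr_diff mult_ac)
  finally show ?thesis by (simp add: I_def)
qed

lemma abs_osc_le:
  assumes fr: "frostman n \<alpha> p h L t" and S: "\<And>i. i < n \<Longrightarrow> \<bar>fst (p i)\<bar> \<le> S"
    and L: "0 \<le> L" and t: "0 \<le> t" "t \<le> 2" and r: "0 < r" "h \<le> r" "r \<le> B"
    and x: "\<bar>fst z\<bar> \<le> m"
  shows "\<bar>osc n \<alpha> p r z\<bar> \<le> (2 * \<bar>S\<bar> + 3 * B) * (m + 4)\<^sup>2 * L * r powr (t - 2)"
proof -
  let ?u = "\<lambda>i. snd z - fst (p i) * fst z - snd (p i)"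
  have "\<bar>osc n \<alpha> p r z\<bar> \<le> (\<Sum>i<n. \<bar>\<alpha> i * wave r (?u i)\<bar>)"
    unfolding osc_def by (rule sum_abs)
  also have "\<dots> \<le> (\<Sum>i<n. if \<bar>?u i\<bar> \<le> 2 * r then \<alpha> i / r else 0)"
  proof (rule sum_mono)
    fix i assume "i \<in> {..<n}"
    then have "0 \<le> \<alpha> i" using fr by (auto simp: frostman_def)
    then show "\<bar>\<alpha> i * wave r (?u i)\<bar> \<le> (if \<bar>?u i\<bar> \<le> 2 * r then \<alpha> i / r else 0)"
      using mult_left_mono[OF abs_wave_le[OF r(1), of "?u i"], of "\<alpha> i"] wave_eq_0[OF r(1), of "?u i"]
      by (auto simp: abs_mult)
  qed
  also have "\<dots> = (\<Sum>i | i < n \<and> \<bar>?u i\<bar> \<le> 2 * r. \<alpha> i) / r"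
    by (subst sum.inter_filter[symmetric]) (auto simp: sum_divide_distrib)
  also have "\<dots> \<le> ((2 * \<bar>S\<bar> + 3 * B) * (m + 4)\<^sup>2 * L * r powr (t - 1)) / r"
    by (intro divide_right_mono frostman_strip[OF fr S L t r x]) (use r in auto)
  also have "\<dots> = (2 * \<bar>S\<bar> + 3 * B) * (m + 4)\<^sup>2 * L * r powr (t - 2)"
    using r powr_diff[of r "t - 1" 1] by simp
  finally show ?thesis .
qed

text \<open>
  The dyadic form of the kernel bound \<open>min (1/r) (r/a\<^sup>2)\<close>: only the least \<open>k\<close> with
  \<open>\<bar>a\<bar> \<le> 2\<^sup>k r\<close> is needed, but a sum over all \<open>k\<close> whose summands depend on the
  second parameter only through membership in a ball can be summed against the measure.
\<close>

lemma abs_integral_pair_int_le: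
  assumes r: "0 < r" and m: "0 \<le> m" and K: "\<bar>fst p - fst p'\<bar> \<le> 2 ^ K * r"
  shows "\<bar>\<integral>z. pair_int m r p p' z \<partial>lborel\<bar>
    \<le> (\<Sum>k\<le>K. if p' \<in> ball p ((m + 7) * (2 ^ k * r)) then 128 * (m + 1)\<^sup>2 / (4 ^ k * r) else 0)"
    (is "_ \<le> (\<Sum>k\<le>K. ?f k)")
proof -
  define a where "a = fst p - fst p'"
  define k where "k = (LEAST k. \<bar>a\<bar> \<le> 2 ^ k * r)"
  have k: "\<bar>a\<bar> \<le> 2 ^ k * r" unfolding k_def by (rule LeastI[of _ K]) (use K in \<open>simp add: a_def\<close>)
  have kK: "k \<le> K" unfolding k_def by (rule Least_le) (use K in \<open>simp add: a_def\<close>)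
  have nn: "0 \<le> ?f j" for j using r by auto
  have "\<bar>\<integral>z. pair_int m r p p' z \<partial>lborel\<bar> \<le> ?f k"
  proof (cases "4 * r + (m + 1) * \<bar>fst p - fst p'\<bar> < \<bar>snd p - snd p'\<bar>")
    case True
    then show ?thesis using nn[of k] integral_pair_int_eq_0[OF r True] by simp
  next
    case False
    have r2: "r \<le> 2 ^ k * r" using r by simp
    have "dist p p' \<le> \<bar>a\<bar> + \<bar>snd p - snd p'\<bar>" unfolding a_def by (rule dist_prod_le)
    also have "\<dots> \<le> \<bar>a\<bar> + (4 * r + (m + 1) * \<bar>a\<bar>)" using False by (simp add: a_def)
    also have "\<dots> \<le> 2 ^ k * r + (4 * (2 ^ k * r) + (m + 1) * (2 ^ k * r))"
      using k r2 m by (intro add_mono mult_left_mono) auto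
    also have "\<dots> < (m + 7) * (2 ^ k * r)" using r by (simp add: algebra_simps)
    finally have in_ball: "p' \<in> ball p ((m + 7) * (2 ^ k * r))" by simp
    have m2: "1 \<le> (m + 1)\<^sup>2" using m by simp
    have "\<bar>\<integral>z. pair_int m r p p' z \<partial>lborel\<bar> \<le> 128 * (m + 1)\<^sup>2 / (4 ^ k * r)"
    proof (cases k)
      case 0
      have "\<bar>\<integral>z. pair_int m r p p' z \<partial>lborel\<bar> \<le> 4 * (2 * (m + 1)\<^sup>2 / r)"
        by (intro integral_pair_int integral_cutoff_wave_trivial r m)
      also have "\<dots> \<le> 128 * (m + 1)\<^sup>2 / (4 ^ k * r)" using 0 r by (simp add: divide_right_mono)
      finally show ?thesis .
    next
      case (Suc j)
      have j: "2 ^ j * r < \<bar>a\<bar>"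
        using not_less_Least[of j "\<lambda>k. \<bar>a\<bar> \<le> 2 ^ k * r"] Suc unfolding k_def by simp
      moreover have "0 < 2 ^ j * r" using r by simp
      ultimately have a0: "a \<noteq> 0" by auto
      have "(2 ^ j * r)\<^sup>2 \<le> a\<^sup>2" using j r by (simp add: abs_le_square_iff[symmetric])
      then have j2: "4 ^ j * (r * r) \<le> a\<^sup>2"
        by (simp add: power2_eq_square mult_ac flip: power_mult_distrib)
      have "\<bar>\<integral>z. pair_int m r p p' z \<partial>lborel\<bar> \<le> 4 * (8 * r / a\<^sup>2)"
        unfolding a_def
        by (intro integral_pair_int integral_cutoff_wave_cancel r m a0[unfolded a_def])
      also have "\<dots> \<le> 4 * (8 * r / (4 ^ j * (r * r)))"
        using r j2 a0 by (intro mult_left_mono divide_left_mono) auto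
      also have "\<dots> = 128 / (4 ^ k * r)" using r Suc by (simp add: field_simps)
      also have "\<dots> \<le> 128 * (m + 1)\<^sup>2 / (4 ^ k * r)" using r m2 by (intro divide_right_mono) auto
      finally show ?thesis .
    qed
    then show ?thesis using in_ball by simp
  qed
  also have "?f k \<le> (\<Sum>k\<le>K. ?f k)"
    by (rule member_le_sum) (use kK nn in auto)
  finally show ?thesis .
qed

lemma cutoff_osc_square:
  "cutoff m (fst z) * (osc n \<alpha> p r z)\<^sup>2
    = (\<Sum>i<n. \<Sum>j<n. \<alpha> i * \<alpha> j * pair_int m r (p i) (p j) z)"
  unfolding osc_def pair_int_def power2_eq_square sum_product
  unfolding sum_distrib_left
  by (intro sum.cong refl) (simp add: mult_ac)

lemma integrable_cutoff_osc_square: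
  assumes "0 < r" "0 \<le> m"
  shows "integrable lborel (\<lambda>z. cutoff m (fst z) * (osc n \<alpha> p r z)\<^sup>2)"
  unfolding cutoff_osc_square
  by (intro Bochner_Integration.integrable_sum integrable_mult_right integrable_pair_int assms)

text \<open>
  At distance \<open>2\<^sup>k r\<close> the kernel is of size \<open>1/(4\<^sup>k r)\<close> and the mass is at most
  \<open>L (2\<^sup>k r)\<^sup>t \<le> 4\<^sup>k L r\<^sup>t\<close> up to constants, as \<open>t \<le> 2\<close>. So each of the \<open>K + 1\<close> dyadic distances
  contributes \<open>L r\<^bsup>t-1\<^esup>\<close>.
\<close>

lemma integral_cutoff_osc_square_le:
  assumes fr: "frostman n \<alpha> p h L t" and S: "\<And>i. i < n \<Longrightarrow> \<bar>fst (p i)\<bar> \<le> S"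
    and L: "0 \<le> L" and t: "0 \<le> t" "t \<le> 2" and r: "0 < r" "h \<le> r" and m: "0 \<le> m"
    and K: "2 * S \<le> 2 ^ K * r"
  shows "(\<integral>z. cutoff m (fst z) * (osc n \<alpha> p r z)\<^sup>2 \<partial>lborel)
    \<le> 128 * (m + 1)\<^sup>2 * (m + 7)\<^sup>2 * real (K + 1) * L * r powr (t - 1)"
proof -
  let ?I = "\<lambda>i j. \<integral>z. pair_int m r (p i) (p j) z \<partial>lborel"
  let ?c = "128 * (m + 1)\<^sup>2"
  let ?D = "?c * (m + 7)\<^sup>2 * real (K + 1) * L * r powr (t - 1)"
  have a0: "0 \<le> \<alpha> i" if "i < n" for i using fr that by (auto simp: frostman_def)
  have row: "(\<Sum>j<n. \<alpha> j * \<bar>?I i j\<bar>) \<le> ?D" if i: "i < n" for i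
  proof -
    have "(\<Sum>j<n. \<alpha> j * \<bar>?I i j\<bar>)
      \<le> (\<Sum>j<n. \<alpha> j * (\<Sum>k\<le>K. if p j \<in> ball (p i) ((m + 7) * (2 ^ k * r)) then ?c / (4 ^ k * r) else 0))"
    proof (intro sum_mono mult_left_mono abs_integral_pair_int_le r m)
      fix j assume "j \<in> {..<n}"
      then show "0 \<le> \<alpha> j" and "\<bar>fst (p i) - fst (p j)\<bar> \<le> 2 ^ K * r"
        using a0 S[of i] S[of j] i K by auto
    qed
    also have "\<dots> = (\<Sum>k\<le>K. \<Sum>j<n. \<alpha> j * (if p j \<in> ball (p i) ((m + 7) * (2 ^ k * r)) then ?c / (4 ^ k * r) else 0))"
      unfolding sum_distrib_left by (rule sum.swap)
    also have "\<dots> \<le> (\<Sum>k\<le>K. ?c * (m + 7)\<^sup>2 * L * r powr (t - 1))"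
    proof (rule sum_mono)
      fix k assume "k \<in> {..K}"
      let ?\<rho> = "(m + 7) * (2 ^ k * r)"
      have "(\<Sum>j<n. \<alpha> j * (if p j \<in> ball (p i) ?\<rho> then ?c / (4 ^ k * r) else 0))
        = (\<Sum>j | j < n \<and> p j \<in> ball (p i) ?\<rho>. \<alpha> j) * (?c / (4 ^ k * r))"
        unfolding sum_distrib_right
        by (rule sum.mono_neutral_cong_right) auto
      also have "\<dots> \<le> (L * ?\<rho> powr t) * (?c / (4 ^ k * r))"
      proof (rule mult_right_mono)
        have "h \<le> r" by fact
        also have "r \<le> 2 ^ k * r" using r by simp
        also have "\<dots> \<le> ?\<rho>" using m r by simp
        finally show "(\<Sum>j | j < n \<and> p j \<in> ball (p i) ?\<rho>. \<alpha> j) \<le> L * ?\<rho> powr t"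
          using fr unfolding frostman_def by blast
      qed (use r in auto)
      also have "\<dots> \<le> (L * ((m + 7)\<^sup>2 * 4 ^ k * r powr t)) * (?c / (4 ^ k * r))"
      proof (intro mult_right_mono mult_left_mono)
        have "?\<rho> powr t = ((m + 7) * 2 ^ k) powr t * r powr t"
          using m r by (simp add: powr_mult)
        also have "((m + 7) * 2 ^ k) powr t \<le> ((m + 7) * 2 ^ k) powr 2"
        proof (rule powr_mono)
          have "1 * 1 \<le> (m + 7) * 2 ^ k" by (rule mult_mono) (use m in auto)
          then show "1 \<le> (m + 7) * 2 ^ k" by simp
        qed (use t in simp)
        also have "((m + 7) * 2 ^ k) powr 2 = ((m + 7) * 2 ^ k)\<^sup>2" using m by simp
        also have "\<dots> = (m + 7)\<^sup>2 * 4 ^ k"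
          by (simp add: power2_eq_square mult_ac flip: power_mult_distrib)
        finally show "?\<rho> powr t \<le> (m + 7)\<^sup>2 * 4 ^ k * r powr t" by (simp add: mult_right_mono)
      qed (use L r in auto)
      also have "\<dots> = ?c * (m + 7)\<^sup>2 * L * r powr (t - 1)"
        using r by (simp add: powr_diff)
      finally show "(\<Sum>j<n. \<alpha> j * (if p j \<in> ball (p i) ?\<rho> then ?c / (4 ^ k * r) else 0))
        \<le> ?c * (m + 7)\<^sup>2 * L * r powr (t - 1)" .
    qed
    also have "\<dots> = ?D" by (simp add: mult_ac)
    finally show ?thesis .
  qed
  have "(\<integral>z. cutoff m (fst z) * (osc n \<alpha> p r z)\<^sup>2 \<partial>lborel) = (\<Sum>i<n. \<Sum>j<n. \<alpha> i * \<alpha> j * ?I i j)"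
    unfolding cutoff_osc_square
    by (simp add: Bochner_Integration.integral_sum integrable_pair_int[OF r(1) m])
  also have "\<dots> \<le> (\<Sum>i<n. \<alpha> i * (\<Sum>j<n. \<alpha> j * \<bar>?I i j\<bar>))"
    unfolding sum_distrib_left
    by (intro sum_mono) (auto intro!: mult_left_mono a0 simp: mult.assoc)
  also have "\<dots> \<le> (\<Sum>i<n. \<alpha> i * ?D)"
    by (intro sum_mono mult_left_mono row a0) auto
  also have "\<dots> = ?D" using fr by (simp add: frostman_def flip: sum_distrib_right)
  finally show ?thesis .
qed

section \<open>Interpolation and summation over the scales\<close>

text \<open>
  The weights \<open>t - 1\<close> and \<open>2 - t\<close> sum to \<open>1\<close> and cancel the powers of \<open>r\<close>:
  \<open>(t - 2) (t - 1) + (t - 1) (2 - t) = 0\<close>.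
\<close>

lemma powr_interpolation:
  fixes X Z r t :: real
  assumes X: "0 \<le> X" and Z: "0 \<le> Z" and r: "0 < r" and t: "1 \<le> t" "t \<le> 2"
    and sup: "X \<le> Z * r powr (t - 2)" and l2: "X\<^sup>2 \<le> Z * r powr (t - 1)"
  shows "X powr (3 - t) \<le> Z"
proof (cases "X = 0")
  case True then show ?thesis using Z by simp
next
  case False
  with X have X0: "0 < X" by simp
  with sup Z have Z0: "0 < Z" by (cases "Z = 0") auto
  have "X powr (3 - t) = X powr (t - 1) * (X powr 2) powr (2 - t)"
    unfolding powr_powr powr_add[symmetric] by (simp add: algebra_simps)
  also have "X powr 2 = X\<^sup>2" using X0 by simp
  also have "X powr (t - 1) * (X\<^sup>2) powr (2 - t)
      \<le> (Z * r powr (t - 2)) powr (t - 1) * (Z * r powr (t - 1)) powr (2 - t)"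
    using X0 t sup l2 by (intro mult_mono powr_mono2) auto
  also have "\<dots> = (Z powr (t - 1) * Z powr (2 - t)) * (r powr ((t - 2) * (t - 1)) * r powr ((t - 1) * (2 - t)))"
    using Z0 r by (simp add: powr_mult powr_powr)
  also have "\<dots> = Z powr 1 * r powr 0"
    by (simp flip: powr_add add: algebra_simps)
  also have "\<dots> = Z" using Z0 r by simp
  finally show ?thesis .
qed

lemma lebesgue_on_borel_bounded:
  fixes g :: "'a::euclidean_space \<Rightarrow> real"
  assumes E: "E \<in> lmeasurable" and g: "g \<in> borel_measurable borel"
    and b: "\<And>z. z \<in> E \<Longrightarrow> \<bar>g z\<bar> \<le> M"
  shows "integrable (lebesgue_on E) g"
proof -
  interpret finite_measure "lebesgue_on E" by (rule finite_measure_lebesgue_on[OF E])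
  have "g \<in> borel_measurable (lebesgue_on E)"
    using g by (intro measurable_restrict_space1 measurable_completion) simp
  then show ?thesis
    by (intro integrable_const_bound[where B = M] AE_I2) (use b in auto)
qed

lemma integral_lebesgue_on_le:
  fixes g :: "'a::euclidean_space \<Rightarrow> real"
  assumes E: "E \<in> lmeasurable" and g: "g \<in> borel_measurable borel"
    and b: "\<And>z. z \<in> E \<Longrightarrow> \<bar>g z\<bar> \<le> M"
  shows "(\<integral>z. \<bar>g z\<bar> \<partial>lebesgue_on E) \<le> measure lebesgue E * M"
proof -
  have "(\<integral>z. \<bar>g z\<bar> \<partial>lebesgue_on E) \<le> (\<integral>z. M \<partial>lebesgue_on E)"
    by (intro integral_mono integrable_abs lebesgue_on_borel_bounded[OF E g b]
        finite_measure.integrable_const[OF finite_measure_lebesgue_on[OF E]])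
      (use b in auto)
  also have "\<dots> = measure lebesgue E * M"
    using E by (simp add: measure_restrict_space)
  finally show ?thesis .
qed

text \<open>
  The Cauchy--Schwarz inequality on \<open>E\<close>, obtained from \<open>0 \<le> \<integral>\<^sub>E (e \<bar>g\<bar> - X)\<^sup>2\<close>. The set is only
  Lebesgue measurable while the weighted integral is a Borel one.
\<close>

lemma integral_lebesgue_on_square_le:
  fixes g w :: "'a::euclidean_space \<Rightarrow> real"
  assumes E: "E \<in> lmeasurable" and g: "g \<in> borel_measurable borel"
    and b: "\<And>z. z \<in> E \<Longrightarrow> \<bar>g z\<bar> \<le> M"
    and w: "\<And>z. 0 \<le> w z" "\<And>z. z \<in> E \<Longrightarrow> 1 \<le> w z"
    and i: "integrable lborel (\<lambda>z. w z * (g z)\<^sup>2)"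
  shows "(\<integral>z. \<bar>g z\<bar> \<partial>lebesgue_on E)\<^sup>2 \<le> measure lebesgue E * (\<integral>z. w z * (g z)\<^sup>2 \<partial>lborel)"
proof -
  define e where "e = measure lebesgue E"
  define X where "X = (\<integral>z. \<bar>g z\<bar> \<partial>lebesgue_on E)"
  define Q where "Q = (\<integral>z. (g z)\<^sup>2 \<partial>lebesgue_on E)"
  let ?f = "\<lambda>z. w z * (g z)\<^sup>2"
  have int1: "integrable (lebesgue_on E) (\<lambda>z. \<bar>g z\<bar>)"
    by (intro integrable_abs lebesgue_on_borel_bounded[OF E g b])
  have int2: "integrable (lebesgue_on E) (\<lambda>z. (g z)\<^sup>2)"
  proof (rule lebesgue_on_borel_bounded[OF E, where M = "M\<^sup>2"])
    show "\<bar>(g z)\<^sup>2\<bar> \<le> M\<^sup>2" if "z \<in> E" for z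
      using power_mono[OF b[OF that], of 2] by simp
  qed (use g in measurable)
  have ic: "integrable (lebesgue_on E) (\<lambda>z. c)" for c :: real
    by (rule finite_measure.integrable_const[OF finite_measure_lebesgue_on[OF E]])
  have me: "measure (lebesgue_on E) E = e"
    using E by (simp add: measure_restrict_space e_def)
  then have c: "(\<integral>z. c \<partial>lebesgue_on E) = e * c" for c :: real
    using me by simp
  have iL: "integrable lebesgue ?f"
    using i by (subst integrable_completion) (auto dest: borel_measurable_integrable)
  have fi: "integrable lebesgue (\<lambda>z. indicator E z *\<^sub>R ?f z)"
    by (rule integrable_mult_indicator[OF _ iL]) (use E in auto)
  have "Q \<le> (\<integral>z. ?f z \<partial>lebesgue_on E)"
    unfolding Q_def
  proof (rule integral_mono[OF int2])
    show "integrable (lebesgue_on E) ?f"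
      using fi E by (subst integrable_restrict_space) auto
    show "(g z)\<^sup>2 \<le> ?f z" if "z \<in> space (lebesgue_on E)" for z
      using mult_right_mono[OF w(2)[of z], of "(g z)\<^sup>2"] that by simp
  qed
  also have "\<dots> = (\<integral>z. indicator E z *\<^sub>R ?f z \<partial>lebesgue)"
    using E by (subst integral_restrict_space) auto
  also have "\<dots> \<le> (\<integral>z. ?f z \<partial>lebesgue)"
    by (rule integral_mono[OF fi iL]) (use w(1) in \<open>auto simp: indicator_def\<close>)
  also have "\<dots> = (\<integral>z. ?f z \<partial>lborel)"
    using i by (intro integral_completion borel_measurable_integrable)
  finally have Q: "Q \<le> (\<integral>z. ?f z \<partial>lborel)" .
  have e0: "0 \<le> e" by (simp add: e_def)
  have "X\<^sup>2 \<le> e * Q"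
  proof (cases "e = 0")
    case True
    have "X \<le> e * M" unfolding X_def e_def by (rule integral_lebesgue_on_le[OF E g b])
    moreover have "0 \<le> X" unfolding X_def by simp
    ultimately show ?thesis using True by simp
  next
    case False
    have "0 \<le> (\<integral>z. (e * \<bar>g z\<bar> - X)\<^sup>2 \<partial>lebesgue_on E)" by simp
    also have "\<dots> = (\<integral>z. e\<^sup>2 * (g z)\<^sup>2 + (- (2 * e * X) * \<bar>g z\<bar> + X\<^sup>2) \<partial>lebesgue_on E)"
      by (rule Bochner_Integration.integral_cong) (auto simp: power2_eq_square algebra_simps)
    also have "\<dots> = e\<^sup>2 * Q + (- (2 * e * X) * X + e * X\<^sup>2)"
      unfolding Q_def X_def
      by (subst Bochner_Integration.integral_add
          | intro integrable_mult_right Bochner_Integration.integrable_add int1 int2 ic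
          | simp add: c me)+
    also have "\<dots> = e * (e * Q - X\<^sup>2)"
      by (simp add: power2_eq_square algebra_simps)
    finally show ?thesis using e0 False by (simp add: zero_le_mult_iff)
  qed
  also have "e * Q \<le> e * (\<integral>z. ?f z \<partial>lborel)" using Q e0 by (rule mult_left_mono)
  finally show ?thesis by (simp add: X_def e_def)
qed

lemma shading_le_integral_avg:
  assumes E: "E \<in> lmeasurable" and a: "\<And>i. i < n \<Longrightarrow> 0 \<le> \<alpha> i" and r: "0 < r"
    and Y: "\<And>i. i < n \<Longrightarrow> Y i \<in> sets lebesgue" "\<And>i. i < n \<Longrightarrow> Y i \<subseteq> E"
    and strip: "\<And>i z. i < n \<Longrightarrow> z \<in> Y i \<Longrightarrow> \<bar>snd z - fst (p i) * fst z - snd (p i)\<bar> \<le> r"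
  shows "(\<Sum>i<n. \<alpha> i * measure lebesgue (Y i)) \<le> r * (\<integral>z. avg n \<alpha> p r z \<partial>lebesgue_on E)"
proof -
  let ?g = "\<lambda>i z. pulse r (snd z - fst (p i) * fst z - snd (p i))"
  have gi: "integrable (lebesgue_on E) (?g i)" for i
  proof (rule lebesgue_on_borel_bounded[OF E, where M = "1 / r"])
    show "?g i \<in> borel_measurable borel" unfolding borel_prod[symmetric] by measurable
  qed (use r in \<open>auto simp: pulse_def\<close>)
  have "measure lebesgue (Y i) \<le> r * (\<integral>z. ?g i z \<partial>lebesgue_on E)" if i: "i < n" for i
  proof -
    have YE: "Y i \<in> sets (lebesgue_on E)"
      using Y[OF i] E by (auto simp: sets_restrict_space_iff)
    have "measure lebesgue (Y i) = (\<integral>z. indicator (Y i) z \<partial>lebesgue_on E)"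
      using YE Y[OF i] E by (simp add: measure_restrict_space Int_absorb2)
    also have "\<dots> \<le> (\<integral>z. r * ?g i z \<partial>lebesgue_on E)"
    proof (rule integral_mono)
      show "integrable (lebesgue_on E) (indicator (Y i) :: _ \<Rightarrow> real)"
        using YE finite_measure.emeasure_finite[OF finite_measure_lebesgue_on[OF E]]
        by (intro integrable_real_indicator) (auto simp: less_top)
      show "indicator (Y i) z \<le> r * ?g i z" for z
        using strip[OF i, of z] r by (auto simp: indicator_def pulse_def)
    qed (intro integrable_mult_right gi)
    finally show ?thesis by simp
  qed
  then have "(\<Sum>i<n. \<alpha> i * measure lebesgue (Y i)) \<le> (\<Sum>i<n. \<alpha> i * (r * (\<integral>z. ?g i z \<partial>lebesgue_on E)))"
    by (intro sum_mono mult_left_mono a) auto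
  also have "\<dots> = r * (\<Sum>i<n. \<integral>z. \<alpha> i * ?g i z \<partial>lebesgue_on E)"
    by (simp add: sum_distrib_left mult_ac)
  also have "(\<Sum>i<n. \<integral>z. \<alpha> i * ?g i z \<partial>lebesgue_on E) = (\<integral>z. avg n \<alpha> p r z \<partial>lebesgue_on E)"
    unfolding avg_def
    by (rule Bochner_Integration.integral_sum[symmetric]) (intro integrable_mult_right gi)
  finally show ?thesis .
qed

lemma abs_avg_le:
  assumes "frostman n \<alpha> p h L t" and "0 < r"
  shows "\<bar>avg n \<alpha> p r z\<bar> \<le> 1 / r"
proof -
  have "\<bar>avg n \<alpha> p r z\<bar> \<le> (\<Sum>i<n. \<bar>\<alpha> i * pulse r (snd z - fst (p i) * fst z - snd (p i))\<bar>)"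
    unfolding avg_def by (rule sum_abs)
  also have "\<dots> \<le> (\<Sum>i<n. \<alpha> i * (1 / r))"
    using assms by (intro sum_mono) (auto simp: frostman_def pulse_def)
  also have "\<dots> = 1 / r"
    using assms by (simp add: frostman_def flip: sum_divide_distrib)
  finally show ?thesis .
qed

text \<open>
  The estimate with explicit constants. The summands of \<open>D\<close> come from the pointwise bound, the
  mean-square bound and the area of the bounded region containing all shadings, in this order;
  one factor \<open>N + 1\<close> counts the dyadic distances in the mean-square bound and the other two arise
  from adding the \<open>N + 1\<close> terms of the telescoping sum before raising to the power \<open>q \<le> 2\<close>.
\<close>

lemma union_measure_lower_bound:
  fixes m S T B :: real and K :: nat
  defines "D \<equiv> (2 * S + 3 * B) * (m + 4)\<^sup>2 + 128 * (m + 1)\<^sup>2 * (m + 7)\<^sup>2 * real (K + 1)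
                + (4 * m * (S * m + T + B) + 1)"
  assumes fr: "frostman n \<alpha> p h L t"
    and S: "\<And>i. i < n \<Longrightarrow> \<bar>fst (p i)\<bar> \<le> S" and T: "\<And>i. i < n \<Longrightarrow> \<bar>snd (p i)\<bar> \<le> T"
    and S0: "0 \<le> S" and T0: "0 \<le> T" and m: "0 \<le> m" and B: "1 \<le> B" and K: "2 * S \<le> 2 ^ K"
    and h: "0 < h" "h \<le> 1" and L: "1 \<le> L" and t: "1 \<le> t" "t \<le> 2"
    and N: "1 \<le> 2 ^ N * h" "\<And>k. k < N \<Longrightarrow> 2 ^ k * h < 1"
    and Y: "\<And>i. i < n \<Longrightarrow> Y i \<in> sets lebesgue"
    and x: "\<And>i z. i < n \<Longrightarrow> z \<in> Y i \<Longrightarrow> \<bar>fst z\<bar> \<le> m"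
    and strip: "\<And>i z. i < n \<Longrightarrow> z \<in> Y i \<Longrightarrow> \<bar>snd z - fst (p i) * fst z - snd (p i)\<bar> \<le> B * h"
  shows "(inverse h * (\<Sum>i<n. \<alpha> i * measure lebesgue (Y i))) powr (3 - t)
      \<le> B\<^sup>2 * D * real (N + 1) ^ 3 * L * measure lebesgue (\<Union>i<n. Y i)"
proof -
  define E where "E = (\<Union>i<n. Y i)"
  define e where "e = measure lebesgue E"
  define R where "R = S * m + T + B"
  define r where "r = (\<lambda>k. 2 ^ k * (B * h))"
  define X where "X = (\<lambda>k. \<integral>z. \<bar>osc n \<alpha> p (r k) z\<bar> \<partial>lebesgue_on E)"
  define q where "q = 3 - t"
  define Z where "Z = D * real (N + 1) * L * e"
  define C1 where "C1 = (2 * S + 3 * B) * (m + 4)\<^sup>2"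
  define C2 where "C2 = 128 * (m + 1)\<^sup>2 * (m + 7)\<^sup>2"
  define E0 where "E0 = 4 * m * R + 1"
  have q: "1 \<le> q" "q \<le> 2" using t by (auto simp: q_def)
  have R0: "0 \<le> R" using S0 m T0 B by (simp add: R_def)
  have E_sub: "E \<subseteq> cbox (-m, -R) (m, R)"
  proof
    fix z assume "z \<in> E"
    then obtain i where i: "i < n" "z \<in> Y i" by (auto simp: E_def)
    have 1: "\<bar>fst z\<bar> \<le> m" using x[OF i] .
    have "\<bar>fst (p i) * fst z\<bar> \<le> S * m"
      unfolding abs_mult by (intro mult_mono) (use S[OF i(1)] 1 S0 in auto)
    moreover have "B * h \<le> B" using B h by simp
    ultimately have "\<bar>snd z\<bar> \<le> R" using strip[OF i] T[OF i(1)] unfolding R_def by linarith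
    with 1 show "z \<in> cbox (-m, -R) (m, R)" by (cases z) (auto simp: cbox_Pair_eq)
  qed
  have "bounded E" using E_sub bounded_cbox bounded_subset by blast
  then have Em: "E \<in> lmeasurable"
    by (rule bounded_set_imp_lmeasurable) (use Y in \<open>auto simp: E_def\<close>)
  have xE: "\<bar>fst z\<bar> \<le> m" if "z \<in> E" for z using that x unfolding E_def by blast
  have e0: "0 \<le> e" by (simp add: e_def)
  have e_le: "e \<le> E0"
  proof -
    have "e \<le> measure lebesgue (cbox (-m, -R) (m, R))"
      unfolding e_def by (rule measure_mono_fmeasurable[OF E_sub]) (use Em in auto)
    also have "\<dots> = (2 * m) * (2 * R)"
      using m R0 by (simp add: content_Pair)
    finally show ?thesis by (simp add: E0_def)
  qed
  have C0: "0 \<le> C1" "0 \<le> C2" "1 \<le> E0" using S0 B m R0 by (auto simp: C1_def C2_def E0_def)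
  have D: "D = C1 + C2 * real (K + 1) + E0" by (simp add: D_def C1_def C2_def E0_def R_def)
  have CK0: "0 \<le> C2 * real (K + 1)" using C0 by simp
  have NL: "1 \<le> real (N + 1) * L" using mult_mono[of 1 "real (N + 1)" 1 L] L by simp
  have Z0: "0 \<le> Z" unfolding Z_def D using e0 C0 CK0 L by (intro mult_nonneg_nonneg) auto
  \<comment> \<open>The term at scale 1 contributes at most \<open>e\<close>, and \<open>e\<^bsup>q\<^esup> = e\<^bsup>q-1\<^esup> e\<close> is linear in \<open>e\<close> up to a constant because \<open>e\<close> is bounded.\<close>
  have q_le: "e \<le> Z powr (1 / q)"
  proof (cases "e = 0")
    case False
    with e0 have e1: "0 < e" by simp
    have "e powr q = e powr (q - 1) * e powr 1" using e1 by (subst powr_add[symmetric]) simp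
    also have "\<dots> \<le> E0 powr 1 * e"
    proof (rule mult_mono)
      have "e powr (q - 1) \<le> E0 powr (q - 1)" using e0 e_le q by (intro powr_mono2) auto
      also have "\<dots> \<le> E0 powr 1" using C0 q by (intro powr_mono) auto
      finally show "e powr (q - 1) \<le> E0 powr 1" .
    qed (use e1 in auto)
    also have "\<dots> \<le> D * e" using C0 CK0 e0 by (intro mult_right_mono) (auto simp: D)
    also have "\<dots> * 1 \<le> (D * e) * (real (N + 1) * L)"
      by (rule mult_left_mono[OF NL]) (use e0 C0 CK0 in \<open>auto simp: D\<close>)
    also have "\<dots> = Z" by (simp add: Z_def mult_ac)
    finally have "(e powr q) powr (1 / q) \<le> Z powr (1 / q)" using q by (intro powr_mono2) auto
    then show ?thesis using q e1 by (simp add: powr_powr)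
  qed simp
  have X_le: "X k \<le> Z powr (1 / q)" if k: "k < N" for k
  proof -
    have rk: "0 < r k" using B h by (simp add: r_def)
    have hr: "h \<le> r k"
    proof -
      have "1 * 1 \<le> 2 ^ k * B" by (rule mult_mono) (use B in auto)
      from mult_right_mono[OF this, of h] h show ?thesis by (simp add: r_def mult_ac)
    qed
    have rB: "r k \<le> B"
      using N(2)[OF k] B mult_left_mono[of "2 ^ k * h" 1 B] by (simp add: r_def mult_ac)
    have bd: "\<bar>osc n \<alpha> p (r k) z\<bar> \<le> C1 * L * r k powr (t - 2)" if "z \<in> E" for z
      using abs_osc_le[OF fr S _ _ _ rk hr rB xE[OF that]] L t S0 by (simp add: C1_def)
    have X0: "0 \<le> X k" by (simp add: X_def)
    have "X k \<le> e * (C1 * L * r k powr (t - 2))"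
      unfolding X_def e_def by (rule integral_lebesgue_on_le[OF Em _ bd]) auto
    also have "\<dots> = (C1 * 1 * L * e) * r k powr (t - 2)" by simp
    also have "\<dots> \<le> Z * r k powr (t - 2)"
      unfolding Z_def by (intro mult_right_mono mult_mono) (use C0 CK0 L e0 in \<open>auto simp: D\<close>)
    finally have 1: "X k \<le> Z * r k powr (t - 2)" .
    have "(X k)\<^sup>2 \<le> e * (\<integral>z. cutoff m (fst z) * (osc n \<alpha> p (r k) z)\<^sup>2 \<partial>lborel)"
      unfolding X_def e_def
      by (rule integral_lebesgue_on_square_le[OF Em _ bd])
         (use integrable_cutoff_osc_square[OF rk m] cutoff_nonneg cutoff_ge_1 xE in auto)
    also have "\<dots> \<le> e * (128 * (m + 1)\<^sup>2 * (m + 7)\<^sup>2 * (real (N + K + 1)) * L * r k powr (t - 1))"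
    proof (rule mult_left_mono[OF integral_cutoff_osc_square_le[OF fr S _ _ _ rk hr m]])
      have "2 * S * 1 \<le> 2 ^ K * (2 ^ N * h)" using K N(1) S0 by (intro mult_mono) auto
      also have "\<dots> \<le> 2 ^ K * (2 ^ N * r k)" using hr by (intro mult_left_mono) auto
      finally show "2 * S \<le> 2 ^ (N + K) * r k" by (simp add: power_add mult_ac)
    qed (use L t e0 in auto)
    also have "\<dots> = (C2 * (real (N + K + 1)) * L * e) * r k powr (t - 1)" by (simp add: C2_def mult_ac)
    also have "\<dots> \<le> Z * r k powr (t - 1)"
    proof (rule mult_right_mono)
      have "real (N + K + 1) \<le> real (K + 1) * real (N + 1)" by (simp add: algebra_simps)
      then have "C2 * (real (N + K + 1)) \<le> C2 * (real (K + 1) * real (N + 1))"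
        using C0 by (intro mult_left_mono)
      also have "\<dots> = C2 * real (K + 1) * real (N + 1)" by (simp add: mult_ac)
      also have "\<dots> \<le> D * real (N + 1)" using C0 by (intro mult_right_mono) (auto simp: D)
      finally show "C2 * (real (N + K + 1)) * L * e \<le> Z"
        unfolding Z_def using L e0 by (intro mult_right_mono) auto
    qed simp
    finally have 2: "(X k)\<^sup>2 \<le> Z * r k powr (t - 1)" .
    have "X k powr q \<le> Z"
      unfolding q_def by (rule powr_interpolation[OF X0 Z0 rk t 1 2])
    then have "(X k powr q) powr (1 / q) \<le> Z powr (1 / q)" using q by (intro powr_mono2) auto
    then show ?thesis using q X0 by (simp add: powr_powr)
  qed
  define \<Lambda> where "\<Lambda> = inverse h * (\<Sum>i<n. \<alpha> i * measure lebesgue (Y i))"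
  have a0: "0 \<le> \<alpha> i" if "i < n" for i using fr that by (auto simp: frostman_def)
  have L0: "0 \<le> \<Lambda>" unfolding \<Lambda>_def using h a0 by (auto intro!: mult_nonneg_nonneg sum_nonneg)
  have Bh: "0 < B * h" using B h by simp
  have osc_int: "integrable (lebesgue_on E) (osc n \<alpha> p (r k))" if "k < N" for k
  proof -
    have "osc n \<alpha> p (r k) = (\<lambda>z. avg n \<alpha> p (r k) z - avg n \<alpha> p (2 * r k) z)"
      by (simp add: fun_eq_iff osc_def avg_def wave_def right_diff_distrib sum_subtractf)
    moreover have "integrable (lebesgue_on E) (avg n \<alpha> p c)" if "0 < c" for c
      by (rule lebesgue_on_borel_bounded[OF Em _ abs_avg_le[OF fr that]]) simp
    ultimately show ?thesis using Bh by (simp add: r_def)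
  qed
  have rN: "1 \<le> r N"
    using mult_mono[OF B N(1)] B h by (simp add: r_def mult_ac)
  have avN: "\<bar>avg n \<alpha> p (r N) z\<bar> \<le> 1" for z
    using abs_avg_le[OF fr, of "r N" z] rN by (simp add: order_trans[OF _ divide_le_eq_1[THEN iffD2]])
  have avNi: "integrable (lebesgue_on E) (avg n \<alpha> p (r N))"
    by (rule lebesgue_on_borel_bounded[OF Em _ avN]) simp
  have "(\<Sum>i<n. \<alpha> i * measure lebesgue (Y i)) \<le> (B * h) * (\<integral>z. avg n \<alpha> p (B * h) z \<partial>lebesgue_on E)"
    by (rule shading_le_integral_avg[OF Em a0 Bh]) (use Y strip in \<open>auto simp: E_def\<close>)
  then have "\<Lambda> \<le> inverse h * ((B * h) * (\<integral>z. avg n \<alpha> p (B * h) z \<partial>lebesgue_on E))"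
    unfolding \<Lambda>_def using h by (intro mult_left_mono) auto
  also have "\<dots> = B * (\<integral>z. avg n \<alpha> p (B * h) z \<partial>lebesgue_on E)" using h by simp
  also have "(\<integral>z. avg n \<alpha> p (B * h) z \<partial>lebesgue_on E)
      = (\<integral>z. avg n \<alpha> p (r N) z + (\<Sum>k<N. osc n \<alpha> p (r k) z) \<partial>lebesgue_on E)"
    by (subst avg_telescope[of _ _ _ _ _ N]) (simp add: r_def)
  also have "\<dots> = (\<integral>z. avg n \<alpha> p (r N) z \<partial>lebesgue_on E)
      + (\<Sum>k<N. \<integral>z. osc n \<alpha> p (r k) z \<partial>lebesgue_on E)"
  proof -
    have "integrable (lebesgue_on E) (\<lambda>z. \<Sum>k<N. osc n \<alpha> p (r k) z)"
      by (intro Bochner_Integration.integrable_sum) (use osc_int in auto)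
    moreover have "(\<integral>z. (\<Sum>k<N. osc n \<alpha> p (r k) z) \<partial>lebesgue_on E)
        = (\<Sum>k<N. \<integral>z. osc n \<alpha> p (r k) z \<partial>lebesgue_on E)"
      by (intro Bochner_Integration.integral_sum) (use osc_int in auto)
    ultimately show ?thesis using Bochner_Integration.integral_add[OF avNi] by simp
  qed
  also have "\<dots> \<le> Z powr (1 / q) + (\<Sum>k<N. Z powr (1 / q))"
  proof (intro add_mono sum_mono)
    have "(\<integral>z. avg n \<alpha> p (r N) z \<partial>lebesgue_on E) \<le> (\<integral>z. \<bar>avg n \<alpha> p (r N) z\<bar> \<partial>lebesgue_on E)"
      by (intro integral_mono avNi integrable_abs) simp
    also have "\<dots> \<le> e * 1" unfolding e_def by (rule integral_lebesgue_on_le[OF Em _ avN]) simp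
    finally show "(\<integral>z. avg n \<alpha> p (r N) z \<partial>lebesgue_on E) \<le> Z powr (1 / q)" using q_le by simp
    fix k assume "k \<in> {..<N}"
    then have k: "k < N" by simp
    have "(\<integral>z. osc n \<alpha> p (r k) z \<partial>lebesgue_on E) \<le> X k"
      unfolding X_def by (intro integral_mono osc_int[OF k] integrable_abs) simp
    then show "(\<integral>z. osc n \<alpha> p (r k) z \<partial>lebesgue_on E) \<le> Z powr (1 / q)" using X_le[OF k] by simp
  qed
  also have "B * (Z powr (1 / q) + (\<Sum>k<N. Z powr (1 / q))) = B * real (N + 1) * Z powr (1 / q)"
    by (simp add: algebra_simps)
  finally have "\<Lambda> \<le> B * real (N + 1) * Z powr (1 / q)" using B by (simp add: mult_left_mono)
  then have "\<Lambda> powr q \<le> (B * real (N + 1) * Z powr (1 / q)) powr q"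
    using L0 q by (intro powr_mono2) auto
  also have "\<dots> = (B * real (N + 1)) powr q * Z"
    using B q Z0 by (simp add: powr_mult powr_powr)
  also have "\<dots> \<le> (B * real (N + 1)) powr 2 * Z"
  proof (intro mult_right_mono powr_mono q Z0)
    show "1 \<le> B * real (N + 1)" using mult_mono[OF B, of 1 "real (N + 1)"] B by simp
  qed
  also have "(B * real (N + 1)) powr 2 = (B * real (N + 1))\<^sup>2" using B by simp
  also have "(B * real (N + 1))\<^sup>2 * Z = B\<^sup>2 * D * real (N + 1) ^ 3 * L * e"
    by (simp add: Z_def power2_eq_square power3_eq_cube mult_ac del: of_nat_add of_nat_Suc)
  finally show ?thesis by (simp add: \<Lambda>_def q_def e_def E_def)
qed

section \<open>Tubes, scales and the theorem\<close>

lemma tube_subset_strip: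
  assumes z: "z \<in> tube Ix Jx A h p" and Ix: "Ix \<noteq> {}" and S: "\<bar>fst p\<bar> \<le> S"
  shows "\<bar>snd z - fst p * fst z - snd p\<bar> \<le> A * (1 + S) * h"
proof -
  have "line_seg Ix p \<noteq> {}" using Ix by (simp add: line_seg_def)
  moreover have "infdist z (line_seg Ix p) < A * h" using z by (simp add: tube_def)
  ultimately obtain w where "w \<in> line_seg Ix p" and w: "dist z w < A * h"
    by (auto simp: infdist_notempty cINF_less_iff)
  then obtain x where x: "w = (x, fst p * x + snd p)" by (auto simp: line_seg_def)
  have 1: "\<bar>fst z - x\<bar> < A * h" "\<bar>snd z - (fst p * x + snd p)\<bar> < A * h"
    using w dist_fst_le[of z w] dist_snd_le[of z w] by (auto simp: x dist_real_def)
  have "\<bar>fst p * (fst z - x)\<bar> \<le> S * (A * h)"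
    unfolding abs_mult by (intro mult_mono) (use S 1 in auto)
  moreover have "snd z - fst p * fst z - snd p = (snd z - (fst p * x + snd p)) - fst p * (fst z - x)"
    by (simp add: algebra_simps)
  ultimately have "\<bar>snd z - fst p * fst z - snd p\<bar> \<le> A * h + S * (A * h)" using 1 by linarith
  then show ?thesis by (simp add: algebra_simps)
qed

lemma scale_count:
  fixes h :: real
  assumes "0 < h"
  obtains N :: nat where "1 \<le> 2 ^ N * h" and "\<And>k. k < N \<Longrightarrow> 2 ^ k * h < 1"
proof -
  obtain M where "1 / h < 2 ^ M" using real_arch_pow[of 2 "1 / h"] by auto
  then have M: "1 \<le> 2 ^ M * h" using assms by (simp add: field_simps)
  define N where "N = (LEAST N. 1 \<le> 2 ^ N * h)"
  show thesis
  proof (rule that[of N])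
    show "1 \<le> 2 ^ N * h" unfolding N_def using M by (rule LeastI)
    show "2 ^ k * h < 1" if "k < N" for k
      using not_less_Least[of k "\<lambda>N. 1 \<le> 2 ^ N * h"] that by (simp add: N_def)
  qed
qed

text \<open>
  Since \<open>N\<close> is at most \<open>1 + log\<^sub>2 (1/h)\<close>, the inequality \<open>ln x \<le> x\<^sup>a / a\<close> with \<open>a = \<epsilon>/3\<close>
  absorbs each of the three factors.
\<close>

lemma scale_count_cube_le:
  fixes h \<epsilon> :: real
  assumes h: "0 < h" "h \<le> 1" and e: "0 < \<epsilon>" and N: "\<And>k. k < N \<Longrightarrow> 2 ^ k * h < 1"
  shows "real (N + 1) ^ 3 * h powr \<epsilon> \<le> (2 + 3 / (\<epsilon> * ln 2)) ^ 3"
proof -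
  let ?a = "\<epsilon> / 3" and ?c = "2 + 3 / (\<epsilon> * ln 2)"
  have l2: "0 < ln (2::real)" by simp
  have h1: "1 \<le> 1 / h" using h by simp
  have "real N \<le> 1 + ln (1 / h) / ln 2"
  proof (cases N)
    case (Suc k)
    then have "2 ^ k < 1 / h" using N[of k] h by (simp add: field_simps)
    then have "ln (2 ^ k) \<le> ln (1 / h)" using h by (intro ln_mono) auto
    then show ?thesis using Suc l2 by (simp add: ln_realpow field_simps)
  qed (use h h1 in simp)
  also have "ln (1 / h) / ln 2 \<le> ((1 / h) powr ?a / ?a) / ln 2"
    using ln_powr_bound[OF h1, of ?a] e by (intro divide_right_mono) auto
  also have "\<dots> = 3 / (\<epsilon> * ln 2) * (1 / h) powr ?a" using e by simp
  finally have "real (N + 1) \<le> 2 * 1 + 3 / (\<epsilon> * ln 2) * (1 / h) powr ?a" by simp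
  also have "\<dots> \<le> 2 * (1 / h) powr ?a + 3 / (\<epsilon> * ln 2) * (1 / h) powr ?a"
    using h1 e by (intro add_mono mult_left_mono ge_one_powr_ge_zero) auto
  also have "\<dots> = ?c * (1 / h) powr ?a" by (simp add: algebra_simps)
  finally have "real (N + 1) ^ 3 \<le> (?c * (1 / h) powr ?a) ^ 3" by (intro power_mono) auto
  also have "\<dots> = ?c ^ 3 * (1 / h) powr \<epsilon>"
  proof -
    have "((1 / h) powr ?a) ^ 3 = (1 / h) powr \<epsilon>"
      using h by (simp add: powr_power)
    then show ?thesis by (simp add: power_mult_distrib)
  qed
  finally have "real (N + 1) ^ 3 * h powr \<epsilon> \<le> ?c ^ 3 * (1 / h) powr \<epsilon> * h powr \<epsilon>"
    by (rule mult_right_mono) simp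
  also have "\<dots> = ?c ^ 3" using h by (simp add: powr_divide)
  finally show ?thesis .
qed

lemma frostman_atomic_measure:
  assumes a: "\<And>i. i < n \<Longrightarrow> 0 < \<alpha> i" and s: "(\<Sum>i<n. \<alpha> i) = 1" and L: "1 \<le> L" and t: "0 \<le> t"
    and b: "\<And>z \<rho>. h \<le> \<rho> \<Longrightarrow> \<rho> \<le> 1 \<Longrightarrow> measure (atomic_measure n \<alpha> p) (ball z \<rho>) \<le> L * \<rho> powr t"
  shows "frostman n \<alpha> p h L t"
  unfolding frostman_def
proof (intro conjI allI impI)
  fix z :: "real \<times> real" and \<rho> :: real assume \<rho>: "h \<le> \<rho>"
  show "(\<Sum>i | i < n \<and> p i \<in> ball z \<rho>. \<alpha> i) \<le> L * \<rho> powr t"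
  proof (cases "\<rho> \<le> 1")
    case True
    then show ?thesis
      using b[OF \<rho> True, of z] measure_atomic_measure[of "ball z \<rho>" n \<alpha> p] a
      by (simp add: less_imp_le)
  next
    case False
    have "(\<Sum>i | i < n \<and> p i \<in> ball z \<rho>. \<alpha> i) \<le> (\<Sum>i<n. \<alpha> i)"
      using a by (intro sum_mono2) (auto simp: less_imp_le)
    also have "\<dots> \<le> L * \<rho> powr t"
      using s mult_mono[OF L ge_one_powr_ge_zero[of \<rho> t]] False t L by simp
    finally show ?thesis .
  qed
qed (use a s in \<open>auto simp: less_imp_le\<close>)

theorem theoremA3:
  fixes Is It Ix Jx :: "real set" and A t q \<epsilon> :: real
  assumes "is_interval Is" and "bounded Is"
    and "is_interval It" and "bounded It"
    and "is_interval Ix" and "bounded Ix" and "Ix \<noteq> {}"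
    and "is_interval Jx" and "bounded Jx" and "Ix \<subseteq> Jx"
    and "1 \<le> A"
    and "1 < t" and "t \<le> 2" and "q = 3 - t"
    and "0 < \<epsilon>"
  shows "\<exists>C>0. \<forall>(h::real) (L::real) (n::nat) (\<alpha> :: nat \<Rightarrow> real)
           (p :: nat \<Rightarrow> real \<times> real) (Y :: nat \<Rightarrow> (real \<times> real) set).
         0 < h \<and> h \<le> 1 \<and> 1 \<le> L \<and>
         (\<forall>i<n. 0 < \<alpha> i) \<and> (\<Sum>i<n. \<alpha> i) = 1 \<and>
         (\<forall>i<n. p i \<in> Is \<times> It) \<and>
         (\<forall>z \<rho>. h \<le> \<rho> \<and> \<rho> \<le> 1 \<longrightarrow>
            measure (atomic_measure n \<alpha> p) (ball z \<rho>) \<le> L * \<rho> powr t) \<and>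
         (\<forall>i<n. Y i \<in> sets lebesgue \<and> Y i \<subseteq> tube Ix Jx A h (p i))
         \<longrightarrow>
         (let \<Lambda> = inverse h * (\<Sum>i<n. \<alpha> i * measure lebesgue (Y i)) in
            C * L powr (- q) * h powr \<epsilon> * \<Lambda> powr q
              \<le> measure lebesgue (\<Union>i<n. Y i))"
proof -
  obtain S where S: "0 < S" "\<And>s. s \<in> Is \<Longrightarrow> \<bar>s\<bar> \<le> S"
    using \<open>bounded Is\<close> by (auto simp: bounded_pos)
  obtain T where T: "0 < T" "\<And>\<tau>. \<tau> \<in> It \<Longrightarrow> \<bar>\<tau>\<bar> \<le> T"
    using \<open>bounded It\<close> by (auto simp: bounded_pos)
  obtain m where m: "0 < m" "\<And>x. x \<in> Jx \<Longrightarrow> \<bar>x\<bar> \<le> m"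
    using \<open>bounded Jx\<close> by (auto simp: bounded_pos)
  obtain K where "2 * S < 2 ^ K" using real_arch_pow[of 2 "2 * S"] by auto
  then have K: "2 * S \<le> 2 ^ K" by simp
  \<comment> \<open>Euclidean distance \<open>A h\<close> from a segment of slope at most \<open>S\<close> means vertical distance at most \<open>B h\<close>.\<close>
  define B where "B = A * (1 + S)"
  have B: "1 \<le> B"
    using mult_mono[OF \<open>1 \<le> A\<close>, of 1 "1 + S"] S \<open>1 \<le> A\<close> by (simp add: B_def)
  define D where "D = (2 * S + 3 * B) * (m + 4)\<^sup>2 + 128 * (m + 1)\<^sup>2 * (m + 7)\<^sup>2 * real (K + 1)
                + (4 * m * (S * m + T + B) + 1)"
  have D: "0 < D"
    unfolding D_def using S T m B by (intro add_nonneg_pos) auto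
  define G where "G = B\<^sup>2 * D * (2 + 3 / (\<epsilon> * ln 2)) ^ 3"
  have G: "0 < G"
    unfolding G_def using B D \<open>0 < \<epsilon>\<close> by (intro mult_pos_pos zero_less_power add_pos_pos) auto
  show ?thesis
  proof (intro exI[of _ "1 / G"] conjI allI impI)
    show "0 < 1 / G" using G by simp
    fix h L :: real and n :: nat and \<alpha> :: "nat \<Rightarrow> real" and p :: "nat \<Rightarrow> real \<times> real"
      and Y :: "nat \<Rightarrow> (real \<times> real) set"
    assume H: "0 < h \<and> h \<le> 1 \<and> 1 \<le> L \<and>
         (\<forall>i<n. 0 < \<alpha> i) \<and> (\<Sum>i<n. \<alpha> i) = 1 \<and>
         (\<forall>i<n. p i \<in> Is \<times> It) \<and>
         (\<forall>z \<rho>. h \<le> \<rho> \<and> \<rho> \<le> 1 \<longrightarrow>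
            measure (atomic_measure n \<alpha> p) (ball z \<rho>) \<le> L * \<rho> powr t) \<and>
         (\<forall>i<n. Y i \<in> sets lebesgue \<and> Y i \<subseteq> tube Ix Jx A h (p i))"
    then have h: "0 < h" "h \<le> 1" and L: "1 \<le> L" by auto
    have pS: "\<bar>fst (p i)\<bar> \<le> S" and pT: "\<bar>snd (p i)\<bar> \<le> T" if "i < n" for i
      using H that S(2)[of "fst (p i)"] T(2)[of "snd (p i)"] by (auto simp: mem_Times_iff)
    have Yt: "Y i \<in> sets lebesgue" "Y i \<subseteq> tube Ix Jx A h (p i)" if "i < n" for i
      using H that by auto
    have fr: "frostman n \<alpha> p h L t"
      by (rule frostman_atomic_measure) (use H \<open>1 < t\<close> in auto)
    obtain N where N: "1 \<le> 2 ^ N * h" "\<And>k. k < N \<Longrightarrow> 2 ^ k * h < 1"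
      using scale_count[OF h(1)] by blast
    define \<Lambda> where "\<Lambda> = inverse h * (\<Sum>i<n. \<alpha> i * measure lebesgue (Y i))"
    define e where "e = measure lebesgue (\<Union>i<n. Y i)"
    have e0: "0 \<le> e" by (simp add: e_def)
    have x: "\<bar>fst z\<bar> \<le> m" if "i < n" "z \<in> Y i" for i z
    proof -
      have "z \<in> tube Ix Jx A h (p i)" using Yt(2)[OF that(1)] that(2) by blast
      then show ?thesis using m(2) by (simp add: tube_def)
    qed
    have strip: "\<bar>snd z - fst (p i) * fst z - snd (p i)\<bar> \<le> B * h" if "i < n" "z \<in> Y i" for i z
      unfolding B_def using Yt(2)[OF that(1)] that(2)
      by (intro tube_subset_strip[OF _ \<open>Ix \<noteq> {}\<close> pS[OF that(1)]]) blast
    have main: "\<Lambda> powr q \<le> B\<^sup>2 * D * real (N + 1) ^ 3 * L * e"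
      unfolding \<Lambda>_def e_def D_def \<open>q = 3 - t\<close>
      by (rule union_measure_lower_bound[OF fr pS pT _ _ _ B K h L _ _ N Yt(1) x strip])
         (use S T m \<open>1 < t\<close> \<open>t \<le> 2\<close> in auto)
    have Lq: "L powr (- q) * L \<le> 1"
    proof -
      have "L powr (- q) * L = L powr (1 - q)" using L by (simp add: powr_diff powr_minus field_simps)
      also have "\<dots> \<le> L powr 0" using L \<open>t \<le> 2\<close> \<open>q = 3 - t\<close> by (intro powr_mono) auto
      finally show ?thesis using L by simp
    qed
    have "1 / G * L powr (- q) * h powr \<epsilon> * \<Lambda> powr q
        \<le> 1 / G * L powr (- q) * h powr \<epsilon> * (B\<^sup>2 * D * real (N + 1) ^ 3 * L * e)"
      using main G by (intro mult_left_mono) auto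
    also have "\<dots> = 1 / G * B\<^sup>2 * D * e * ((L powr (- q) * L) * (real (N + 1) ^ 3 * h powr \<epsilon>))"
      by (simp add: mult_ac)
    also have "\<dots> \<le> 1 / G * B\<^sup>2 * D * e * (1 * (2 + 3 / (\<epsilon> * ln 2)) ^ 3)"
      using G D e0 L Lq scale_count_cube_le[OF h \<open>0 < \<epsilon>\<close> N(2)]
      by (intro mult_left_mono mult_mono mult_nonneg_nonneg) auto
    also have "\<dots> = 1 / G * G * e" by (simp add: G_def mult_ac)
    also have "\<dots> = e" using G by simp
    finally show "let \<Lambda> = inverse h * (\<Sum>i<n. \<alpha> i * measure lebesgue (Y i)) in
            1 / G * L powr (- q) * h powr \<epsilon> * \<Lambda> powr q \<le> measure lebesgue (\<Union>i<n. Y i)"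
      by (simp add: Let_def \<Lambda>_def e_def)
  qed
qed

end
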